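(* Let $\ell_1,\dots,\ell_d$ be linear forms on $\mathbb{R}^n$ and let $P = \{ \mathbf{x} \in \mathbb{R}^n : \ell_i(\mathbf{x}) \ge 0 \text{ for } i = 1,\dots,d \}$ be a full-dimensional polyhedral cone. Let $\mathbf{e}$ be a point in the interior of $P$ and assume that $\ell_i(\mathbf{e}) = 1$ for all $i=1,\dots,d$. Let $p(\mathbf{x}) = \ell_1(\mathbf{x})\,\ell_2(\mathbf{x})\cdots \ell_d(\mathbf{x})$. Then the first derivative cone $\Lambda^1_{p,\mathbf{e}}$ of $(p,\mathbf{e})$ is exactly the set of all $\mathbf{x} \in \mathbb{R}^n$ satisfying \[ \begin{bmatrix} \ell_1(\mathbf{x}) + \ell_d(\mathbf{x}) & \ell_d(\mathbf{x}) & \cdots & \ell_d(\mathbf{x}) \\ \ell_d(\mathbf{x}) & \ell_2(\mathbf{x}) + \ell_d(\mathbf{x}) & \cdots & \ell_d(\mathbf{x}) \\ \vdots & \vdots & \ddots & \vdots \\ \ell_d(\mathbf{x}) & \ell_d(\mathbf{x}) & \cdots & \ell_{d-1}(\mathbf{x}) + \ell_d(\mathbf{x}) \end{bmatrix} \ \succeq \ 0, \] where the matrix is the symmetric $(d-1)\times(d-1)$ matrix with $i$-th diagonal entry $\ell_i(\mathbf{x})+\ell_d(\mathbf{x})$ and all off-diagonal entries equal to $\ell_d(\mathbf{x})$.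
   Context: A homogeneous polynomial $q \in \mathbb{R}[x_1,\dots,x_n]$ is hyperbolic with respect to $\mathbf{e}\in\mathbb{R}^n$ if $q(\mathbf{e})>0$ and for every $\mathbf{v}\in\mathbb{R}^n$ the univariate polynomial $\lambda \mapsto q(\mathbf{v}+\lambda\mathbf{e})$ has only real roots. The hyperbolicity cone $\Lambda_{q,\mathbf{e}}$ is the closure of the connected component of $\mathbb{R}^n\setminus\{\mathbf{x} : q(\mathbf{x})=0\}$ containing $\mathbf{e}$; it is a convex cone. The product $p=\ell_1\cdots\ell_d$ is hyperbolic with respect to any $\mathbf{e}$ in the interior of $P$, and $\Lambda_{p,\mathbf{e}}=P$. The first polar of $p$ with respect to $\mathbf{e}$ is $R^1_{\mathbf{e}}p(\mathbf{x}) = \sum_i e_i \frac{\partial}{\partial x_i}p(\mathbf{x}) = \langle \nabla p(\mathbf{x}),\mathbf{e}\rangle$; it is again hyperbolic with respect to $\mathbf{e}$ (by Rolle's theorem). The first derivative cone of $(p,\mathbf{e})$, also called the first derivative cone of $P$, is $\Lambda^1_{p,\mathbf{e}} = \Lambda_{R^1_{\mathbf{e}}p,\,\mathbf{e}}$. The notation $M\succeq 0$ means that the real symmetric matrix $M$ is positive semidefinite (for $d=1$ the matrix is empty and the condition is vacuous). *)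

theory Defs
  imports "HOL-Analysis.Analysis" "Jordan_Normal_Form.Matrix"
begin

text \<open>
  A polynomial in n real variables is represented by the function it induces on \<open>real ^ 'n\<close>
  (over an infinite field nothing is lost), so that formal partial derivatives are the
  analytic ones.
\<close>

definition partial_derivative :: "'n::finite \<Rightarrow> (real ^ 'n \<Rightarrow> real) \<Rightarrow> real ^ 'n \<Rightarrow> real" where
  "partial_derivative i q x = deriv (\<lambda>t. q (x + t *\<^sub>R axis i 1)) 0"

definition first_polar :: "real ^ 'n::finite \<Rightarrow> (real ^ 'n \<Rightarrow> real) \<Rightarrow> real ^ 'n \<Rightarrow> real" where
  "first_polar e q x = (\<Sum>i\<in>UNIV. vec_nth e i * partial_derivative i q x)"

text \<open>
  The set below is the hyperbolicity cone when \<open>q\<close> is a homogeneous polynomial that is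
  hyperbolic with respect to \<open>e\<close>; the formula itself does not refer to hyperbolicity.
\<close>

definition hyperbolicity_cone :: "(real ^ 'n::finite \<Rightarrow> real) \<Rightarrow> real ^ 'n \<Rightarrow> (real ^ 'n) set" where
  "hyperbolicity_cone q e = closure (connected_component_set (UNIV - {x. q x = 0}) e)"

definition first_derivative_cone :: "(real ^ 'n::finite \<Rightarrow> real) \<Rightarrow> real ^ 'n \<Rightarrow> (real ^ 'n) set" where
  "first_derivative_cone p e = hyperbolicity_cone (first_polar e p) e"

text \<open>For a matrix with no rows the condition is vacuously true.\<close>

definition positive_semidefinite :: "real Matrix.mat \<Rightarrow> bool" where
  "positive_semidefinite A \<longleftrightarrow>
     square_mat A \<and> transpose_mat A = A \<and>
     (\<forall>v \<in> carrier_vec (dim_row A). 0 \<le> scalar_prod v (mult_mat_vec A v))"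

text \<open>
  Matrix entries are indexed from 0 whereas the forms are \<open>l 1, \<dots>, l d\<close>; hence \<open>Suc i\<close>.
\<close>

definition derivative_cone_matrix :: "nat \<Rightarrow> (nat \<Rightarrow> real ^ 'n::finite \<Rightarrow> real) \<Rightarrow> real ^ 'n \<Rightarrow> real Matrix.mat" where
  "derivative_cone_matrix d l x =
     Matrix.mat (d - 1) (d - 1) (\<lambda>(i, j). if i = j then l (Suc i) x + l d x else l d x)"

end

theory Submission
  imports Defs
begin

text \<open>
  Put \<open>a\<^sub>i = \<ell>\<^sub>i(x)\<close>. Setting \<open>w\<^sub>d = - (w\<^sub>1 + \<dots> + w\<^sub>d\<^sub>-\<^sub>1)\<close>, the quadratic form of the matrix at \<open>x\<close>
  becomes the diagonal form \<open>\<Sum> a\<^sub>i w\<^sub>i\<^sup>2\<close> on the hyperplane \<open>\<Sum> w\<^sub>i = 0\<close>, while the first polar of \<open>p\<close>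
  at \<open>x\<close> is the elementary symmetric polynomial \<open>\<sigma>\<^sub>d\<^sub>-\<^sub>1(a)\<close>. The form is positive definite on the
  hyperplane iff it is positive semidefinite there and \<open>\<sigma>\<^sub>d\<^sub>-\<^sub>1(a) \<noteq> 0\<close>, and also iff
  \<open>\<sigma>\<^sub>d\<^sub>-\<^sub>1(a) > 0\<close> and at most one \<open>a\<^sub>i\<close> is not positive. Hence the positive definite locus is
  convex, and both open and closed in the complement of the zero set of the polar, so it is the
  component of \<open>e\<close>. Its closure is the semidefinite locus, as adding a positive multiple of \<open>e\<close>
  turns a semidefinite point into a definite one.
\<close>

section \<open>Diagonal quadratic forms on the zero-sum hyperplane\<close>

definition zero_sum_psd :: "'a set \<Rightarrow> ('a \<Rightarrow> real) \<Rightarrow> bool" where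
  "zero_sum_psd I a \<longleftrightarrow> (\<forall>w. sum w I = 0 \<longrightarrow> 0 \<le> (\<Sum>i\<in>I. a i * (w i)\<^sup>2))"

definition zero_sum_pd :: "'a set \<Rightarrow> ('a \<Rightarrow> real) \<Rightarrow> bool" where
  "zero_sum_pd I a \<longleftrightarrow>
     (\<forall>w. sum w I = 0 \<longrightarrow> (\<exists>i\<in>I. w i \<noteq> 0) \<longrightarrow> 0 < (\<Sum>i\<in>I. a i * (w i)\<^sup>2))"

text \<open>For finite nonempty \<open>I\<close> this is the elementary symmetric polynomial of
  degree \<open>card I - 1\<close>, in a form free of division because the \<open>a i\<close> may
  vanish.\<close>

definition sum_prod_omit :: "'a set \<Rightarrow> ('a \<Rightarrow> real) \<Rightarrow> real" where
  "sum_prod_omit I a = (\<Sum>i\<in>I. \<Prod>j\<in>I - {i}. a j)"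

lemma zero_sum_pd_imp_psd:
  assumes "zero_sum_pd I a"
  shows "zero_sum_psd I a"
  unfolding zero_sum_psd_def
proof (intro allI impI)
  fix w :: "_ \<Rightarrow> real" assume w: "sum w I = 0"
  show "0 \<le> (\<Sum>i\<in>I. a i * (w i)\<^sup>2)"
  proof (cases "\<exists>i\<in>I. w i \<noteq> 0")
    case True
    then show ?thesis using assms w unfolding zero_sum_pd_def by fastforce
  next
    case False
    then show ?thesis by simp
  qed
qed

text \<open>The product omitting some \<open>i \<noteq> k\<close> arises from the one omitting
  \<open>k\<close> by trading the factor \<open>a i\<close> for \<open>a k\<close>. Isolating an
  entry that may be zero or negative leaves a sign to be read off from the last factor.\<close>

lemma sum_prod_omit_split:
  assumes "finite I" "k \<in> I" "\<And>i. i \<in> I - {k} \<Longrightarrow> a i \<noteq> 0"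
  shows "sum_prod_omit I a = (\<Prod>i\<in>I - {k}. a i) * (1 + a k * (\<Sum>i\<in>I - {k}. 1 / a i))"
proof -
  have "(\<Prod>j\<in>I - {i}. a j) = (\<Prod>j\<in>I - {k}. a j) * (a k * (1 / a i))" if "i \<in> I - {k}" for i
  proof -
    have "(\<Prod>j\<in>I - {k}. a j) = a i * (\<Prod>j\<in>I - {k} - {i}. a j)"
      using assms that by (intro prod.remove) auto
    moreover have "(\<Prod>j\<in>I - {i}. a j) = a k * (\<Prod>j\<in>I - {i} - {k}. a j)"
      using assms that by (intro prod.remove) auto
    moreover have "I - {i} - {k} = I - {k} - {i}" by auto
    ultimately show ?thesis using assms(3)[OF that] by simp
  qed
  then have "(\<Sum>i\<in>I - {k}. \<Prod>j\<in>I - {i}. a j)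
      = (\<Sum>i\<in>I - {k}. (\<Prod>j\<in>I - {k}. a j) * (a k * (1 / a i)))"
    by (intro sum.cong) auto
  then show ?thesis
    unfolding sum_prod_omit_def
    by (simp add: sum.remove[OF assms(1,2)] sum_distrib_left distrib_left)
qed

text \<open>The difference of two unit vectors is the test vector behind the pairwise bounds below:
  a semidefinite form has at most one negative entry, a definite one at most one nonpositive
  entry.\<close>

lemma sum_mult_square_transposition:
  assumes "finite I" "i \<in> I" "j \<in> I" "i \<noteq> j"
  defines "w \<equiv> (\<lambda>m. if m = i then 1 else if m = j then - 1 else (0::real))"
  shows "sum w I = 0" "(\<Sum>m\<in>I. a m * (w m)\<^sup>2) = a i + a j"
proof -
  have *: "sum f I = f i + f j" if "\<And>m. m \<noteq> i \<Longrightarrow> m \<noteq> j \<Longrightarrow> f m = 0" for f :: "_ \<Rightarrow> real"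
  proof -
    have "sum f I = sum f {i, j}"
      using assms that by (intro sum.mono_neutral_right) auto
    then show ?thesis using assms by simp
  qed
  show "sum w I = 0" using assms(4) by (subst *) (auto simp: w_def)
  show "(\<Sum>m\<in>I. a m * (w m)\<^sup>2) = a i + a j"
    using assms(4) by (subst *) (auto simp: w_def)
qed

lemma zero_sum_psd_add_nonneg:
  assumes "zero_sum_psd I a" "finite I" "i \<in> I" "j \<in> I" "i \<noteq> j"
  shows "0 \<le> a i + a j"
  using sum_mult_square_transposition[OF assms(2-5)] assms(1)
  unfolding zero_sum_psd_def by metis

lemma zero_sum_pd_add_pos:
  assumes "zero_sum_pd I a" "finite I" "i \<in> I" "j \<in> I" "i \<noteq> j"
  shows "0 < a i + a j"
proof -
  define w where "w = (\<lambda>m. if m = i then 1 else if m = j then - 1 else (0::real))"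
  have "sum w I = 0" "(\<Sum>m\<in>I. a m * (w m)\<^sup>2) = a i + a j"
    using sum_mult_square_transposition[OF assms(2-5)] by (simp_all add: w_def)
  moreover have "w i \<noteq> 0" by (simp add: w_def)
  ultimately show ?thesis using assms(1,3) unfolding zero_sum_pd_def by metis
qed

text \<open>Cauchy-Schwarz bounds \<open>(w k)\<^sup>2\<close> by \<open>s * T\<close>, so for
  negative \<open>a k\<close> the form is at least \<open>(1 + a k * s) * T\<close>. The sign of
  \<open>sum_prod_omit\<close> makes the first factor positive.\<close>

lemma zero_sum_pdI:
  assumes fin: "finite I" and k: "k \<in> I" and pos: "\<And>i. i \<in> I - {k} \<Longrightarrow> 0 < a i"
    and q: "0 < sum_prod_omit I a"
  shows "zero_sum_pd I a"
  unfolding zero_sum_pd_def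
proof (intro allI impI)
  fix w :: "_ \<Rightarrow> real" assume w: "sum w I = 0" and nz: "\<exists>i\<in>I. w i \<noteq> 0"
  define s where "s = (\<Sum>i\<in>I - {k}. 1 / a i)"
  define T where "T = (\<Sum>i\<in>I - {k}. a i * (w i)\<^sup>2)"
  have wk: "w k = - sum w (I - {k})"
    using w sum.remove[OF fin k, of w] by simp
  have split: "(\<Sum>i\<in>I. a i * (w i)\<^sup>2) = a k * (w k)\<^sup>2 + T"
    unfolding T_def by (rule sum.remove[OF fin k])
  \<comment> \<open>If every entry off \<open>k\<close> vanished, the zero sum would force
    \<open>w k = 0\<close> as well.\<close>
  obtain j where j: "j \<in> I - {k}" "w j \<noteq> 0"
    using nz wk by (metis DiffI add.inverse_neutral singletonD sum.neutral)
  have T: "0 < T"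
    unfolding T_def using fin j pos
    by (intro sum_pos2[of _ j]) (auto simp: less_imp_le)
  have "0 < (\<Prod>i\<in>I - {k}. a i)" using pos by (intro prod_pos) auto
  moreover have "sum_prod_omit I a = (\<Prod>i\<in>I - {k}. a i) * (1 + a k * s)"
    unfolding s_def using pos by (intro sum_prod_omit_split[OF fin k]) force
  ultimately have ks: "0 < 1 + a k * s" using q by (simp add: zero_less_mult_iff)
  have "(\<Sum>i\<in>I - {k}. (1 / sqrt (a i)) * (sqrt (a i) * w i))\<^sup>2
      \<le> (\<Sum>i\<in>I - {k}. (1 / sqrt (a i))\<^sup>2) * (\<Sum>i\<in>I - {k}. (sqrt (a i) * w i)\<^sup>2)"
    by (rule Cauchy_Schwarz_ineq_sum)
  moreover have "(\<Sum>i\<in>I - {k}. (1 / sqrt (a i)) * (sqrt (a i) * w i)) = sum w (I - {k})"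
    using pos by (intro sum.cong) force+
  moreover have "(\<Sum>i\<in>I - {k}. (1 / sqrt (a i))\<^sup>2) = s"
    unfolding s_def using pos by (intro sum.cong) (auto simp: power_divide less_imp_le)
  moreover have "(\<Sum>i\<in>I - {k}. (sqrt (a i) * w i)\<^sup>2) = T"
    unfolding T_def using pos by (intro sum.cong) (auto simp: power_mult_distrib less_imp_le)
  ultimately have CS: "(w k)\<^sup>2 \<le> s * T" by (simp add: wk)
  show "0 < (\<Sum>i\<in>I. a i * (w i)\<^sup>2)"
  proof (cases "0 \<le> a k")
    case True
    then show ?thesis using T by (simp add: split add_nonneg_pos)
  next
    case False
    then have "a k * (s * T) \<le> a k * (w k)\<^sup>2" using CS by (intro mult_left_mono_neg) auto
    moreover have "0 < (1 + a k * s) * T" using ks T by simp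
    ultimately show ?thesis by (simp add: split algebra_simps)
  qed
qed

text \<open>If all entries are nonzero, a vanishing value makes \<open>1 / a i\<close> a nonzero
  zero-sum vector on which the form is 0. If one entry vanishes, definiteness makes the others
  nonzero, and the product omitting that entry is the only surviving term.\<close>

lemma zero_sum_pd_imp_sum_prod_omit_nonzero:
  assumes fin: "finite I" and k: "k \<in> I" and pd: "zero_sum_pd I a"
  shows "sum_prod_omit I a \<noteq> 0"
proof
  assume q: "sum_prod_omit I a = 0"
  show False
  proof (cases "\<exists>i\<in>I. a i = 0")
    case True
    then obtain i where i: "i \<in> I" "a i = 0" by blast
    have "a j \<noteq> 0" if "j \<in> I - {i}" for j
      using zero_sum_pd_add_pos[OF pd fin i(1), of j] i that by auto
    then show False
      using sum_prod_omit_split[OF fin i(1), of a] q i fin by auto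
  next
    case False
    have P: "(\<Prod>i\<in>I - {k}. a i) \<noteq> 0" using fin False by auto
    have "1 + a k * (\<Sum>i\<in>I - {k}. 1 / a i) = 0"
      using sum_prod_omit_split[OF fin k, of a] q False P by auto
    then have "(\<Sum>i\<in>I. 1 / a i) = 0"
      using False k by (simp add: sum.remove[OF fin k] field_simps)
    moreover have "(\<Sum>i\<in>I. a i * (1 / a i)\<^sup>2) = (\<Sum>i\<in>I. 1 / a i)"
      using False by (intro sum.cong) (auto simp: power2_eq_square)
    moreover have "1 / a k \<noteq> 0" using False k by simp
    ultimately show False
      using pd[unfolded zero_sum_pd_def, rule_format, of "\<lambda>i. 1 / a i"] k by fastforce
  qed
qed

lemma zero_sum_psd_imp_at_most_one_nonpos:
  assumes fin: "finite I" and ne: "I \<noteq> {}" and psd: "zero_sum_psd I a"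
    and q: "sum_prod_omit I a \<noteq> 0"
  shows "0 < sum_prod_omit I a \<and> (\<exists>k\<in>I. \<forall>i\<in>I - {k}. 0 < a i)"
proof (cases "\<exists>k\<in>I. a k < 0")
  case True
  then obtain k where k: "k \<in> I" "a k < 0" by blast
  have pos: "0 < a i" if "i \<in> I - {k}" for i
    using zero_sum_psd_add_nonneg[OF psd fin k(1), of i] k that by auto
  define s where "s = (\<Sum>i\<in>I - {k}. 1 / a i)"
  \<comment> \<open>This is the equality case of Cauchy-Schwarz: off \<open>k\<close>, entries
    proportional to \<open>1 / a i\<close> minimize the positive part of the form for a given sum.
    The form then takes the value \<open>s * (1 + a k * s)\<close>.\<close>
  define w where "w = (\<lambda>i. if i = k then - s else 1 / a i)"
  have s0: "0 \<le> s" unfolding s_def using pos by (intro sum_nonneg) (auto simp: less_imp_le)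
  have "sum w (I - {k}) = s" unfolding s_def w_def by (intro sum.cong) auto
  then have "sum w I = 0" by (simp add: sum.remove[OF fin k(1)] w_def)
  then have "0 \<le> (\<Sum>i\<in>I. a i * (w i)\<^sup>2)" using psd unfolding zero_sum_psd_def by blast
  also have "\<dots> = a k * s\<^sup>2 + (\<Sum>i\<in>I - {k}. a i * (w i)\<^sup>2)"
    by (simp add: sum.remove[OF fin k(1)] w_def)
  also have "(\<Sum>i\<in>I - {k}. a i * (w i)\<^sup>2) = s"
    unfolding s_def
  proof (rule sum.cong)
    fix i assume "i \<in> I - {k}"
    with pos[OF this] show "a i * (w i)\<^sup>2 = 1 / a i" by (simp add: w_def power2_eq_square)
  qed simp
  finally have "0 \<le> s * (1 + a k * s)" by (simp add: power2_eq_square algebra_simps)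
  \<comment> \<open>The case \<open>s = 0\<close> is that of \<open>I = {k}\<close>, where the
    factor is 1.\<close>
  then have "0 \<le> 1 + a k * s" using s0 by (cases "s = 0") (auto simp: zero_le_mult_iff)
  moreover have "0 < (\<Prod>i\<in>I - {k}. a i)" using pos by (intro prod_pos) auto
  moreover have "sum_prod_omit I a = (\<Prod>i\<in>I - {k}. a i) * (1 + a k * s)"
    unfolding s_def using pos by (intro sum_prod_omit_split[OF fin k(1)]) force
  ultimately have "0 \<le> sum_prod_omit I a" by simp
  then show ?thesis using q k pos by force
next
  case False
  then have nonneg: "0 \<le> a i" if "i \<in> I" for i using that by force
  then have "0 \<le> sum_prod_omit I a"
    unfolding sum_prod_omit_def by (intro sum_nonneg prod_nonneg) auto
  \<comment> \<open>Some summand is nonzero; its factors are nonnegative and none is 0, so only the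
    omitted entry can vanish.\<close>
  moreover obtain k where k: "k \<in> I" "(\<Prod>j\<in>I - {k}. a j) \<noteq> 0"
    using q unfolding sum_prod_omit_def by (meson sum.neutral)
  moreover have "0 < a i" if "i \<in> I - {k}" for i
    using nonneg[of i] k(2) fin that by (metis DiffD1 finite_Diff order_less_le prod_zero)
  ultimately show ?thesis using q by force
qed

lemma zero_sum_psd_add_const:
  assumes fin: "finite I" and psd: "zero_sum_psd I a" and t: "0 < t"
  shows "zero_sum_pd I (\<lambda>i. a i + t)"
  unfolding zero_sum_pd_def
proof (intro allI impI)
  fix w :: "_ \<Rightarrow> real" assume w: "sum w I = 0" and "\<exists>i\<in>I. w i \<noteq> 0"
  then obtain j where j: "j \<in> I" "w j \<noteq> 0" by blast
  have "0 < (\<Sum>i\<in>I. t * (w i)\<^sup>2)"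
    using t j by (intro sum_pos2[OF fin j(1)]) auto
  moreover have "0 \<le> (\<Sum>i\<in>I. a i * (w i)\<^sup>2)" using psd w unfolding zero_sum_psd_def by blast
  ultimately show "0 < (\<Sum>i\<in>I. (a i + t) * (w i)\<^sup>2)"
    by (simp add: distrib_right sum.distrib)
qed

lemma zero_sum_pd_convex:
  assumes "zero_sum_pd I a" "zero_sum_pd I b" and uv: "0 \<le> u" "0 \<le> v" "u + v = 1"
  shows "zero_sum_pd I (\<lambda>i. u * a i + v * b i)"
  unfolding zero_sum_pd_def
proof (intro allI impI)
  fix w :: "_ \<Rightarrow> real" assume w: "sum w I = 0" "\<exists>i\<in>I. w i \<noteq> 0"
  have "0 < (\<Sum>i\<in>I. a i * (w i)\<^sup>2)" "0 < (\<Sum>i\<in>I. b i * (w i)\<^sup>2)"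
    using assms w unfolding zero_sum_pd_def by blast+
  then have "0 < u * (\<Sum>i\<in>I. a i * (w i)\<^sup>2) + v * (\<Sum>i\<in>I. b i * (w i)\<^sup>2)"
    using uv by (cases "u = 0") (auto intro: add_pos_nonneg)
  then show "0 < (\<Sum>i\<in>I. (u * a i + v * b i) * (w i)\<^sup>2)"
    by (simp add: distrib_right sum.distrib sum_distrib_left mult.assoc)
qed

section \<open>The matrix as a diagonal form on the hyperplane\<close>

lemma scalar_prod_derivative_cone_matrix:
  assumes "v \<in> carrier_vec (d - 1)"
  shows "scalar_prod v (mult_mat_vec (derivative_cone_matrix d l x) v) =
    (\<Sum>i<d - 1. l (Suc i) x * (vec_index v i)\<^sup>2) + l d x * (\<Sum>i<d - 1. vec_index v i)\<^sup>2"
proof -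
  let ?m = "d - 1"
  have dv: "dim_vec v = ?m" using assms by auto
  have row: "vec_index (mult_mat_vec (derivative_cone_matrix d l x) v) i
      = l (Suc i) x * vec_index v i + l d x * (\<Sum>j<?m. vec_index v j)" if i: "i < ?m" for i
  proof -
    have "vec_index (mult_mat_vec (derivative_cone_matrix d l x) v) i
      = (\<Sum>j<?m. (if i = j then l (Suc i) x + l d x else l d x) * vec_index v j)"
      using i dv
      by (auto simp: derivative_cone_matrix_def scalar_prod_def lessThan_atLeast0 intro!: sum.cong)
    \<comment> \<open>The matrix is a diagonal one plus \<open>l d x\<close> times the all-ones
      matrix, and the latter contributes the coordinate sum.\<close>
    also have "\<dots> = (\<Sum>j<?m. (if i = j then l (Suc i) x * vec_index v j else 0) + l d x * vec_index v j)"
      by (intro sum.cong) (auto simp: algebra_simps)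
    also have "\<dots> = l (Suc i) x * vec_index v i + l d x * (\<Sum>j<?m. vec_index v j)"
      using i by (simp add: sum.distrib sum_distrib_left)
    finally show ?thesis .
  qed
  have "scalar_prod v (mult_mat_vec (derivative_cone_matrix d l x) v)
    = (\<Sum>i<?m. vec_index v i * vec_index (mult_mat_vec (derivative_cone_matrix d l x) v) i)"
    by (simp add: scalar_prod_def lessThan_atLeast0 derivative_cone_matrix_def)
  also have "\<dots> = (\<Sum>i<?m. l (Suc i) x * (vec_index v i)\<^sup>2
      + vec_index v i * (l d x * (\<Sum>j<?m. vec_index v j)))"
    by (intro sum.cong) (auto simp: row power2_eq_square algebra_simps)
  also have "\<dots> = (\<Sum>i<?m. l (Suc i) x * (vec_index v i)\<^sup>2)
      + l d x * (\<Sum>i<?m. vec_index v i)\<^sup>2"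
    by (simp add: sum.distrib power2_eq_square flip: sum_distrib_right)
  finally show ?thesis .
qed

lemma positive_semidefinite_derivative_cone_matrix_iff:
  assumes "d \<ge> 1"
  shows "positive_semidefinite (derivative_cone_matrix d l x) \<longleftrightarrow> zero_sum_psd {1..d} (\<lambda>i. l i x)"
proof -
  let ?M = "derivative_cone_matrix d l x" and ?m = "d - 1"
  have split: "sum f {1..d} = (\<Sum>i<?m. f (Suc i)) + f d" for f :: "nat \<Rightarrow> real"
  proof -
    obtain m where "d = Suc m" using assms by (cases d) auto
    then show ?thesis by (simp add: sum.atLeast1_atMost_eq)
  qed
  have dim: "dim_row ?M = ?m" "dim_col ?M = ?m" "transpose_mat ?M = ?M"
    by (auto simp: derivative_cone_matrix_def intro!: eq_matI)
  have "zero_sum_psd {1..d} (\<lambda>i. l i x)"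
    if M: "\<And>v. v \<in> carrier_vec ?m \<Longrightarrow> 0 \<le> scalar_prod v (mult_mat_vec ?M v)"
    unfolding zero_sum_psd_def
  proof (intro allI impI)
    fix w :: "nat \<Rightarrow> real" assume "sum w {1..d} = 0"
    then have wd: "w d = - (\<Sum>i<?m. w (Suc i))" unfolding split by simp
    define v where "v = Matrix.vec ?m (\<lambda>i. w (Suc i))"
    have "v \<in> carrier_vec ?m" by (simp add: v_def)
    \<comment> \<open>Since \<open>w d\<close> is minus the coordinate sum, the all-ones term is
      exactly the summand with index \<open>d\<close>.\<close>
    from M[OF this] show "0 \<le> (\<Sum>i = 1..d. l i x * (w i)\<^sup>2)"
      unfolding scalar_prod_derivative_cone_matrix[OF \<open>v \<in> carrier_vec ?m\<close>] split
      by (simp add: wd v_def)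
  qed
  moreover have "0 \<le> scalar_prod v (mult_mat_vec ?M v)"
    if psd: "zero_sum_psd {1..d} (\<lambda>i. l i x)" and v: "v \<in> carrier_vec ?m" for v
  proof -
    \<comment> \<open>Coordinates of \<open>v\<close> start at 0 and those of \<open>w\<close> at 1;
      the entry at \<open>d\<close> restores the zero sum. For \<open>d = 1\<close> the vector
      \<open>v\<close> is empty and \<open>w 1 = 0\<close>.\<close>
    define w where "w = (\<lambda>i. if i = d then - (\<Sum>i<?m. vec_index v i) else vec_index v (i - 1))"
    have w: "w d = - (\<Sum>i<?m. vec_index v i)" "\<And>i. i < ?m \<Longrightarrow> w (Suc i) = vec_index v i"
      by (auto simp: w_def)
    then have "sum w {1..d} = 0" unfolding split by simp
    then have "0 \<le> (\<Sum>i = 1..d. l i x * (w i)\<^sup>2)" using psd unfolding zero_sum_psd_def by blast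
    then show ?thesis
      unfolding scalar_prod_derivative_cone_matrix[OF v] split by (simp add: w)
  qed
  ultimately show ?thesis unfolding positive_semidefinite_def by (auto simp: dim)
qed

section \<open>The first polar of a product of linear forms\<close>

lemma first_polar_prod_linear:
  fixes l :: "'a \<Rightarrow> real ^ 'n::finite \<Rightarrow> real"
  assumes lin: "\<And>i. i \<in> I \<Longrightarrow> linear (l i)" and one: "\<And>i. i \<in> I \<Longrightarrow> l i e = 1"
  shows "first_polar e (\<lambda>x. \<Prod>i\<in>I. l i x) x = sum_prod_omit I (\<lambda>i. l i x)"
proof -
  have pd: "partial_derivative k (\<lambda>x. \<Prod>i\<in>I. l i x) x
      = (\<Sum>i\<in>I. l i (axis k 1) * (\<Prod>j\<in>I - {i}. l j x))" for k
  proof -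
    have eq: "(\<lambda>t. \<Prod>i\<in>I. l i (x + t *\<^sub>R axis k 1)) = (\<lambda>t. \<Prod>i\<in>I. l i x + t * l i (axis k 1))"
      using lin by (intro ext prod.cong) (auto simp: linear_add linear_cmul)
    have "((\<lambda>t. \<Prod>i\<in>I. l i x + t * l i (axis k 1)) has_field_derivative
        (\<Sum>i\<in>I. l i (axis k 1) * (\<Prod>j\<in>I - {i}. l j x + 0 * l j (axis k 1)))) (at 0)"
      by (rule has_field_derivative_prod) (auto intro!: derivative_eq_intros)
    then show ?thesis
      unfolding partial_derivative_def eq by (simp add: DERIV_imp_deriv)
  qed
  \<comment> \<open>Contracting the gradient with \<open>e\<close> evaluates each form at
    \<open>e\<close>, and the normalization turns every weight into 1.\<close>
  have e: "(\<Sum>k\<in>UNIV. vec_nth e k * l i (axis k 1)) = 1" if "i \<in> I" for i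
  proof -
    have "l i e = l i (\<Sum>k\<in>UNIV. vec_nth e k *\<^sub>R axis k 1)"
      using basis_expansion[of e] by (simp add: scalar_mult_eq_scaleR)
    also have "\<dots> = (\<Sum>k\<in>UNIV. vec_nth e k * l i (axis k 1))"
      using lin[OF that] by (simp add: linear_sum linear_cmul)
    finally show ?thesis using one[OF that] by simp
  qed
  have "first_polar e (\<lambda>x. \<Prod>i\<in>I. l i x) x
      = (\<Sum>k\<in>UNIV. \<Sum>i\<in>I. vec_nth e k * l i (axis k 1) * (\<Prod>j\<in>I - {i}. l j x))"
    unfolding first_polar_def pd by (simp add: sum_distrib_left mult.assoc)
  also have "\<dots> = (\<Sum>i\<in>I. (\<Sum>k\<in>UNIV. vec_nth e k * l i (axis k 1)) * (\<Prod>j\<in>I - {i}. l j x))"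
    by (subst sum.swap) (simp add: sum_distrib_right)
  also have "\<dots> = sum_prod_omit I (\<lambda>i. l i x)"
    unfolding sum_prod_omit_def using e by (intro sum.cong) auto
  finally show ?thesis .
qed

section \<open>Connected components and the derivative cone\<close>

lemma connected_component_set_eqI:
  assumes "connected U" "e \<in> U" "U \<subseteq> S" "openin (top_of_set S) U" "closedin (top_of_set S) U"
  shows "connected_component_set S e = U"
proof
  show "U \<subseteq> connected_component_set S e"
    using assms by (intro connected_component_maximal) auto
  let ?C = "connected_component_set S e"
  have CS: "?C \<subseteq> S" by (rule connected_component_subset)
  \<comment> \<open>\<open>U\<close> meets the component in a relatively clopen set, which contains
    \<open>e\<close> and so must be all of it.\<close>
  have "openin (top_of_set ?C) (?C \<inter> U)" "closedin (top_of_set ?C) (?C \<inter> U)"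
    using CS assms(4,5) unfolding openin_open closedin_closed by blast+
  then have "?C \<inter> U = {} \<or> ?C \<inter> U = ?C"
    using connected_connected_component[of S e] unfolding connected_clopen by blast
  moreover have "e \<in> ?C \<inter> U" using assms by auto
  ultimately show "?C \<subseteq> U" by blast
qed

theorem theorem1p1:
  fixes l :: "nat \<Rightarrow> real ^ 'n::finite \<Rightarrow> real"
    and d :: nat
    and e :: "real ^ 'n"
    and P :: "(real ^ 'n) set"
    and p :: "real ^ 'n \<Rightarrow> real"
  assumes "d \<ge> 1"
    and "\<And>i. i \<in> {1..d} \<Longrightarrow> linear (l i)"
    and "P = {x. \<forall>i\<in>{1..d}. l i x \<ge> 0}"
    and "aff_dim P = int CARD('n)"
    and "e \<in> interior P"
    and "\<And>i. i \<in> {1..d} \<Longrightarrow> l i e = 1"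
    and "p = (\<lambda>x. \<Prod>i=1..d. l i x)"
  shows "first_derivative_cone p e =
    {x. positive_semidefinite (derivative_cone_matrix d l x)}"
proof -
  let ?I = "{1..d}"
  define q where "q = (\<lambda>x. sum_prod_omit ?I (\<lambda>i. l i x))"
  define S where "S = {x. zero_sum_psd ?I (\<lambda>i. l i x)}"
  define U where "U = {x. zero_sum_pd ?I (\<lambda>i. l i x)}"
  have ne: "?I \<noteq> {}" and fin: "finite ?I" using assms(1) by auto
  have lin: "linear (l i)" if "i \<in> ?I" for i using assms(2) that .
  have cont: "continuous_on A (l i)" if "i \<in> ?I" for i A
    using linear_continuous_on[OF linear_conv_bounded_linear[THEN iffD1, OF lin[OF that]]] .
  have contq: "continuous_on UNIV q"
    unfolding q_def sum_prod_omit_def by (intro continuous_intros cont) auto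
  have polar: "first_polar e p = q"
    unfolding assms(7) q_def using lin assms(6) by (intro ext first_polar_prod_linear) auto
  have US: "U \<subseteq> S" unfolding U_def S_def using zero_sum_pd_imp_psd by blast
  \<comment> \<open>The first description shows that \<open>U\<close> is open, the second that it is
    relatively closed off the zero set of \<open>q\<close> once \<open>S\<close> is closed.\<close>
  have U_eq: "U = {x. q x > 0 \<and> (\<exists>k\<in>?I. \<forall>i\<in>?I - {k}. 0 < l i x)}" (is "_ = ?V")
    and U_eq': "U = {x. q x \<noteq> 0} \<inter> S"
  proof -
    have "U \<subseteq> {x. q x \<noteq> 0} \<inter> S"
      using zero_sum_pd_imp_sum_prod_omit_nonzero[OF fin] ne US unfolding U_def q_def by blast
    moreover have "{x. q x \<noteq> 0} \<inter> S \<subseteq> ?V"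
      using zero_sum_psd_imp_at_most_one_nonpos[OF fin ne] unfolding S_def q_def by auto
    moreover have "?V \<subseteq> U"
      unfolding U_def q_def using zero_sum_pdI[OF fin, where a = "\<lambda>i. l i _"] by fast
    ultimately show "U = ?V" "U = {x. q x \<noteq> 0} \<inter> S" by blast+
  qed
  have "U = {x. q x > 0} \<inter> (\<Union>k\<in>?I. \<Inter>i\<in>?I - {k}. {x. 0 < l i x})"
    unfolding U_eq by auto
  moreover have "open {x. q x > 0}" using contq by (intro open_Collect_less) auto
  moreover have "open {x. 0 < l i x}" if "i \<in> ?I" for i
    using cont[OF that] by (intro open_Collect_less) auto
  ultimately have openU: "open U"
    by (auto intro!: open_Int open_UN open_INT)
  have "S = (\<Inter>w\<in>{w. sum w ?I = 0}. {x. 0 \<le> (\<Sum>i\<in>?I. l i x * (w i)\<^sup>2)})"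
    unfolding S_def zero_sum_psd_def by auto
  moreover have "closed {x. 0 \<le> (\<Sum>i\<in>?I. l i x * (w i)\<^sup>2)}" for w
    by (intro closed_Collect_le continuous_intros cont) auto
  ultimately have closedS: "closed S" by auto
  \<comment> \<open>The forms are known to be linear only for indices in \<open>?I\<close>, so
    rewriting by linearity goes through a congruence on these indices.\<close>
  have pd_cong: "zero_sum_pd ?I a \<longleftrightarrow> zero_sum_pd ?I b" if "\<And>i. i \<in> ?I \<Longrightarrow> a i = b i" for a b
    unfolding zero_sum_pd_def using that by auto
  have "convex U"
  proof (rule convexI)
    fix x y and u v :: real
    assume xy: "x \<in> U" "y \<in> U" and uv: "0 \<le> u" "0 \<le> v" "u + v = 1"
    have "zero_sum_pd ?I (\<lambda>i. u * l i x + v * l i y)"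
      using xy uv unfolding U_def by (intro zero_sum_pd_convex) auto
    then show "u *\<^sub>R x + v *\<^sub>R y \<in> U"
      unfolding U_def mem_Collect_eq
      by (rule pd_cong[THEN iffD1, rotated]) (simp add: lin linear_add linear_cmul)
  qed
  have add_e: "x + t *\<^sub>R e \<in> U" if "x \<in> S" "0 < t" for x t
  proof -
    have "zero_sum_pd ?I (\<lambda>i. l i x + t)"
      using that unfolding S_def by (intro zero_sum_psd_add_const) auto
    then show ?thesis
      unfolding U_def mem_Collect_eq
      by (rule pd_cong[THEN iffD1, rotated]) (simp add: lin linear_add linear_cmul assms(6))
  qed
  \<comment> \<open>The form at the origin is zero, hence semidefinite, and \<open>e\<close> is the
    origin shifted by \<open>1 *\<^sub>R e\<close>.\<close>
  have "0 \<in> S" by (simp add: S_def zero_sum_psd_def linear_0[OF lin])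
  then have eU: "e \<in> U" using add_e[of 0 1] by simp
  have "connected_component_set {x. q x \<noteq> 0} e = U"
    using \<open>convex U\<close> eU openU closedS U_eq'
    by (intro connected_component_set_eqI convex_connected)
      (auto intro: open_subset closedin_closed_Int)
  then have "first_derivative_cone p e = closure U"
    unfolding first_derivative_cone_def hyperbolicity_cone_def polar
    by (simp add: Compl_eq_Diff_UNIV[symmetric] Collect_neg_eq)
  also have "closure U = S"
  proof
    show "closure U \<subseteq> S" using US closedS by (rule closure_minimal)
    show "S \<subseteq> closure U"
    proof
      fix x assume "x \<in> S"
      \<comment> \<open>A semidefinite point is approached by definite ones along the direction
        \<open>e\<close>.\<close>
      have "(\<lambda>n. x + inverse (real (Suc n)) *\<^sub>R e) \<longlonglongrightarrow> x + 0 *\<^sub>R e"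
        by (intro tendsto_intros LIMSEQ_inverse_real_of_nat)
      moreover have "x + inverse (real (Suc n)) *\<^sub>R e \<in> U" for n
        using \<open>x \<in> S\<close> by (intro add_e) auto
      ultimately show "x \<in> closure U"
        unfolding closure_sequential
        by (intro exI[of _ "\<lambda>n. x + inverse (real (Suc n)) *\<^sub>R e"]) simp
    qed
  qed
  finally show ?thesis
    unfolding S_def positive_semidefinite_derivative_cone_matrix_iff[OF assms(1)] .
qed

end
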